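(* No (possibly randomized) online algorithm for Fully Online Bipartite Matching achieves a competitive ratio better than $0.6317$: for every online algorithm $A$, $\inf \mathbb{E}[|A(I)|]/\mathrm{OPT}(I) \le 0.6317$, where the infimum is over all instances $I$ whose underlying graph is bipartite, $|A(I)|$ is the size of the matching produced by $A$, and $\mathrm{OPT}(I)$ is the maximum matching size of the graph.
   Context: Fully Online Bipartite Matching: a bipartite graph $G=(V,E)$ is initially unknown. Time proceeds in steps, each being either the arrival of a vertex $v$ (edges between $v$ and previously-arrived vertices are revealed) or the deadline of a vertex $v$. Each vertex's deadline occurs after its own arrival and after the arrivals of all its neighbours. At the deadline of $v$, if $v$ is not already matched, the algorithm must irrevocably either match $v$ to a currently unmatched neighbour or leave it unmatched. Instances are chosen by an oblivious adversary (not observing the algorithm's random bits); the expectation is over the algorithm's randomness. *)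

theory Defs
  imports "HOL-Probability.Probability"
begin

definition simple_graph :: "'a set \<Rightarrow> 'a set set \<Rightarrow> bool" where
  "simple_graph V E \<longleftrightarrow> finite V \<and> (\<forall>e\<in>E. e \<subseteq> V \<and> card e = 2)"

definition bipartite :: "'a set \<Rightarrow> 'a set set \<Rightarrow> bool" where
  "bipartite V E \<longleftrightarrow>
     (\<exists>L R. L \<union> R = V \<and> L \<inter> R = {} \<and> (\<forall>e\<in>E. \<exists>l\<in>L. \<exists>r\<in>R. e = {l, r}))"

definition matching :: "'a set set \<Rightarrow> 'a set set \<Rightarrow> bool" where
  "matching E M \<longleftrightarrow> M \<subseteq> E \<and> pairwise disjnt M"

definition max_matching_size :: "'a set set \<Rightarrow> nat" where
  "max_matching_size E = Max (card ` {M. matching E M})"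

datatype event = Arrival nat | Deadline nat

datatype fom_instance =
  Fom_Instance (verts: "nat set") (edges: "nat set set") (timeline: "event list")

definition precedes :: "'a list \<Rightarrow> 'a \<Rightarrow> 'a \<Rightarrow> bool" where
  "precedes xs x y \<longleftrightarrow> (\<exists>i j. i < j \<and> j < length xs \<and> xs ! i = x \<and> xs ! j = y)"

definition valid_instance :: "fom_instance \<Rightarrow> bool" where
  "valid_instance I \<longleftrightarrow>
     simple_graph (verts I) (edges I) \<and>
     distinct (timeline I) \<and>
     set (timeline I) = Arrival ` verts I \<union> Deadline ` verts I \<and>
     (\<forall>v\<in>verts I. precedes (timeline I) (Arrival v) (Deadline v)) \<and>
     (\<forall>u v. {u, v} \<in> edges I \<longrightarrow> precedes (timeline I) (Arrival u) (Deadline v))"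

definition OPT :: "fom_instance \<Rightarrow> nat" where
  "OPT I = max_matching_size (edges I)"

text \<open>
  An algorithm never sees the instance itself, only the observations made so far: an arrival
  comes with the set of previously arrived neighbours.
\<close>

datatype observation = Sees_Arrival nat "nat set" | Sees_Deadline nat

definition observe :: "fom_instance \<Rightarrow> nat \<Rightarrow> observation" where
  "observe I i =
     (case timeline I ! i of
        Arrival v \<Rightarrow>
          Sees_Arrival v {u. {u, v} \<in> edges I \<and> Arrival u \<in> set (take i (timeline I))}
      | Deadline v \<Rightarrow> Sees_Deadline v)"

definition history :: "fom_instance \<Rightarrow> nat \<Rightarrow> observation list" where
  "history I n = map (observe I) [0..<n]"

text \<open>
  A policy is a deterministic algorithm. It is consulted at the deadline of an unmatched vertex,
  with a history whose last entry is that deadline, and names the partner (\<open>None\<close>: leave the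
  vertex unmatched). Its own earlier decisions are determined by the history, hence they are not
  an additional argument.
\<close>

type_synonym policy = "observation list \<Rightarrow> nat option"

text \<open>
  The matching after the first \<open>n\<close> events. A vertex that was left unmatched at its own deadline
  stays unmatched, so the chosen partner must not have passed its deadline. Naming an
  inadmissible partner amounts to leaving the vertex unmatched.
\<close>

fun matching_after :: "policy \<Rightarrow> fom_instance \<Rightarrow> nat \<Rightarrow> nat set set" where
  "matching_after p I 0 = {}"
| "matching_after p I (Suc n) =
     (let M = matching_after p I n in
      case timeline I ! n of
        Arrival v \<Rightarrow> M
      | Deadline v \<Rightarrow>
          if v \<in> \<Union>M then M
          else (case p (history I (Suc n)) of
                  None \<Rightarrow> M
                | Some u \<Rightarrow>
                    if {u, v} \<in> edges I \<and> u \<notin> \<Union>M \<and> Deadline u \<notin> set (take n (timeline I))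
                    then insert {u, v} M
                    else M))"

definition final_matching :: "policy \<Rightarrow> fom_instance \<Rightarrow> nat set set" where
  "final_matching p I = matching_after p I (length (timeline I))"

lemma matching_matching_after: "matching (edges I) (matching_after p I n)"
  by (induction n)
     (auto simp: matching_def Let_def pairwise_insert disjnt_def
           split: event.split option.split)

text \<open>
  A randomized algorithm is a random policy on an arbitrary probability space; the instance is
  fixed independently of the outcome \<open>\<omega>\<close> (oblivious adversary).
\<close>

definition randomized_algorithm :: "'w measure \<Rightarrow> ('w \<Rightarrow> policy) \<Rightarrow> bool" where
  "randomized_algorithm W A \<longleftrightarrow>
     prob_space W \<and> (\<forall>h. (\<lambda>\<omega>. A \<omega> h) \<in> measurable W (count_space UNIV))"

definition expected_size :: "'w measure \<Rightarrow> ('w \<Rightarrow> policy) \<Rightarrow> fom_instance \<Rightarrow> real" where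
  "expected_size W A I = (\<integral>\<omega>. real (card (final_matching (A \<omega>) I)) \<partial>W)"

text \<open>
  Edgeless instances are excluded: their ratio is the undefined \<open>0 / 0\<close>, which the logic
  evaluates to \<open>0\<close>, and that would make the infimum trivially \<open>0\<close>.
\<close>

definition competitive_ratio :: "'w measure \<Rightarrow> ('w \<Rightarrow> policy) \<Rightarrow> real" where
  "competitive_ratio W A =
     (INF I \<in> {I. valid_instance I \<and> bipartite (verts I) (edges I) \<and> OPT I > 0}.
        expected_size W A I / real (OPT I))"

end

theory Submission
  imports Defs
begin

text \<open>
  An oblivious adversary knows the distribution of the algorithm, so it may build the instance
  event by event and always retire the live vertex that is most likely to be unmatched. Two moves
  are used on the set of live vertices. Either a single new vertex is joined to all of them, meets
  its deadline at once, and one live vertex is retired as its optimal partner; this is the upper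
  triangular instance behind the bound \<open>1 - 1/e\<close>. Or all live vertices meet their deadlines after
  a larger set of new vertices has been joined to all of them; some of the new vertices are
  retired as optimal partners and the others become the live set. The second move beats
  \<open>1 - 1/e\<close>: live vertices that are already matched contribute nothing more, although the
  optimum still gains one edge for each of them.

  With \<open>G\<close> the expected size of the matching and \<open>X\<close> the expected number of unmatched live
  vertices, every move bounds the new value of \<open>G + c X\<close> by the old value of \<open>G + c' X\<close> and a
  constant. Shrinking 18 live vertices to 10, replacing these by 42 - 10 others, shrinking those
  to 13 and offering 13 last partners has optimum 50 and expected size below 31.58.
\<close>

section \<open>Building instances event by event\<close>

definition arrive :: "nat set \<Rightarrow> nat \<Rightarrow> fom_instance \<Rightarrow> fom_instance" where
  "arrive N v I =
     Fom_Instance (insert v (verts I)) (edges I \<union> (\<lambda>u. {u, v}) ` N) (timeline I @ [Arrival v])"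

definition expire :: "nat \<Rightarrow> fom_instance \<Rightarrow> fom_instance" where
  "expire v I = Fom_Instance (verts I) (edges I) (timeline I @ [Deadline v])"

definition expired :: "fom_instance \<Rightarrow> nat set" where
  "expired I = {v. Deadline v \<in> set (timeline I)}"

text \<open>Instances under construction: some deadlines may still be outstanding. Since a newcomer
  is joined to unexpired vertices only, no vertex can gain a neighbour after its deadline.\<close>

inductive online_prefix :: "fom_instance \<Rightarrow> bool" where
  empty: "online_prefix (Fom_Instance {} {} [])"
| arrive: "\<lbrakk>online_prefix I; v \<notin> verts I; N \<subseteq> verts I - expired I\<rbrakk> \<Longrightarrow> online_prefix (arrive N v I)"
| expire: "\<lbrakk>online_prefix I; v \<in> verts I - expired I\<rbrakk> \<Longrightarrow> online_prefix (expire v I)"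

lemma arrive_simps [simp]:
  "verts (arrive N v I) = insert v (verts I)"
  "edges (arrive N v I) = edges I \<union> (\<lambda>u. {u, v}) ` N"
  "timeline (arrive N v I) = timeline I @ [Arrival v]"
  "expired (arrive N v I) = expired I"
  by (auto simp: arrive_def expired_def)

lemma expire_simps [simp]:
  "verts (expire v I) = verts I"
  "edges (expire v I) = edges I"
  "timeline (expire v I) = timeline I @ [Deadline v]"
  "expired (expire v I) = insert v (expired I)"
  by (auto simp: expire_def expired_def)

lemma fold_arrive_simps [simp]:
  "verts (fold (arrive N) ws I) = verts I \<union> set ws"
  "edges (fold (arrive N) ws I) = edges I \<union> {{u, w} |u w. u \<in> N \<and> w \<in> set ws}"
  "expired (fold (arrive N) ws I) = expired I"
  by (induction ws arbitrary: I) auto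

lemma fold_expire_simps [simp]:
  "verts (fold expire vs I) = verts I"
  "edges (fold expire vs I) = edges I"
  "expired (fold expire vs I) = expired I \<union> set vs"
  by (induction vs arbitrary: I) auto

lemma precedes_append: "precedes xs x y \<Longrightarrow> precedes (xs @ ys) x y"
  unfolding precedes_def by (metis nth_append length_append trans_less_add1 less_trans)

lemma precedes_snoc: "x \<in> set xs \<Longrightarrow> precedes (xs @ [y]) x y"
  unfolding precedes_def
  by (metis in_set_conv_nth length_append_singleton lessI nth_append nth_append_length)

text \<open>These are the validity conditions with deadlines relativised to
  \<open>expired I\<close>; they become \<open>valid_instance\<close> once every vertex has expired.
  A joint induction lets each condition use the others.\<close>

lemma online_prefix_invariants:
  assumes "online_prefix I"
  shows "simple_graph (verts I) (edges I)" and "distinct (timeline I)"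
    and "set (timeline I) = Arrival ` verts I \<union> Deadline ` expired I"
    and "expired I \<subseteq> verts I"
    and "\<forall>v\<in>expired I. precedes (timeline I) (Arrival v) (Deadline v)"
    and "\<forall>u. \<forall>v\<in>expired I. {u, v} \<in> edges I \<longrightarrow> precedes (timeline I) (Arrival u) (Deadline v)"
proof -
  have "simple_graph (verts I) (edges I) \<and> distinct (timeline I) \<and>
    set (timeline I) = Arrival ` verts I \<union> Deadline ` expired I \<and> expired I \<subseteq> verts I \<and>
    (\<forall>v\<in>expired I. precedes (timeline I) (Arrival v) (Deadline v)) \<and>
    (\<forall>u. \<forall>v\<in>expired I. {u, v} \<in> edges I \<longrightarrow> precedes (timeline I) (Arrival u) (Deadline v))"
    using assms
  proof induction
    case empty
    then show ?case by (simp add: simple_graph_def expired_def)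
  next
    case (arrive I v N)
    have "Arrival v \<notin> set (timeline I)"
      using arrive by auto
    moreover have "simple_graph (insert v (verts I)) (edges I \<union> (\<lambda>u. {u, v}) ` N)"
    proof -
      have "card {u, v} = 2" if "u \<in> N" for u
      proof -
        have "u \<noteq> v" using that arrive by auto
        then show ?thesis by simp
      qed
      then show ?thesis
        using arrive by (auto simp: simple_graph_def)
    qed
    \<comment> \<open>An expired \<open>w\<close> lies on no new edge: it is neither the newcomer
      \<open>v\<close> nor in \<open>N\<close>. So the condition is inherited.\<close>
    moreover have "precedes (timeline I) (Arrival u) (Deadline w)"
      if "w \<in> expired I" "{u, w} \<in> edges I \<union> (\<lambda>u. {u, v}) ` N" for u w
    proof -
      have "{u, w} \<notin> (\<lambda>u. {u, v}) ` N"
        using that(1) arrive by (auto simp: doubleton_eq_iff)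
      then show ?thesis using that arrive by blast
    qed
    ultimately show ?case
      using arrive(2,4) by (auto simp only: arrive_simps set_append list.set distinct_append
          distinct.simps intro!: precedes_append)
  next
    case (expire I v)
    have nd: "Deadline v \<notin> set (timeline I)"
      using expire(2) by (simp add: expired_def)
    have "precedes (timeline I @ [Deadline v]) (Arrival u) (Deadline v)" if "u \<in> verts I" for u
      using that expire(3) by (intro precedes_snoc) simp
    moreover have "u \<in> verts I" if "{u, v} \<in> edges I" for u
      using that expire(3) by (auto simp: simple_graph_def)
    ultimately have
      "\<forall>w\<in>insert v (expired I). precedes (timeline I @ [Deadline v]) (Arrival w) (Deadline w)"
      "\<forall>u. \<forall>w\<in>insert v (expired I). {u, w} \<in> edges I \<longrightarrow>
        precedes (timeline I @ [Deadline v]) (Arrival u) (Deadline w)"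
      using expire(2,3) by (metis DiffD1 insertE precedes_append)+
    moreover have "set (timeline I @ [Deadline v]) = Arrival ` verts I \<union> Deadline ` insert v (expired I)"
      using expire(3) by auto
    ultimately show ?case
      using expire(2,3) nd by simp
  qed
  then show "simple_graph (verts I) (edges I)" and "distinct (timeline I)"
    and "set (timeline I) = Arrival ` verts I \<union> Deadline ` expired I"
    and "expired I \<subseteq> verts I"
    and "\<forall>v\<in>expired I. precedes (timeline I) (Arrival v) (Deadline v)"
    and "\<forall>u. \<forall>v\<in>expired I. {u, v} \<in> edges I \<longrightarrow> precedes (timeline I) (Arrival u) (Deadline v)"
    by blast+
qed

lemma online_prefix_finite:
  assumes "online_prefix I"
  shows "finite (verts I)" "finite (edges I)" "\<And>e. e \<in> edges I \<Longrightarrow> e \<subseteq> verts I"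
proof -
  show "finite (verts I)" and sub: "\<And>e. e \<in> edges I \<Longrightarrow> e \<subseteq> verts I"
    using online_prefix_invariants(1)[OF assms] by (auto simp: simple_graph_def)
  then show "finite (edges I)"
    by (meson Pow_iff finite_Pow_iff finite_subset subsetI)
qed

lemma online_prefix_fold_arrive:
  "\<lbrakk>online_prefix I; distinct ws; set ws \<inter> verts I = {}; N \<subseteq> verts I - expired I\<rbrakk>
    \<Longrightarrow> online_prefix (fold (arrive N) ws I)"
proof (induction ws arbitrary: I)
  case (Cons w ws)
  have "online_prefix (fold (arrive N) ws (arrive N w I))"
    using Cons.prems by (intro Cons.IH online_prefix.arrive) auto
  then show ?case by simp
qed simp

lemma online_prefix_fold_expire:
  "\<lbrakk>online_prefix I; distinct vs; set vs \<subseteq> verts I - expired I\<rbrakk>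
    \<Longrightarrow> online_prefix (fold expire vs I)"
proof (induction vs arbitrary: I)
  case (Cons v vs)
  have "online_prefix (fold expire vs (expire v I))"
    using Cons.prems by (intro Cons.IH online_prefix.expire) auto
  then show ?case by simp
qed simp

lemma valid_instanceI:
  assumes "online_prefix I" "expired I = verts I"
  shows "valid_instance I"
proof -
  note inv = online_prefix_invariants[OF assms(1), unfolded assms(2)]
  have "v \<in> verts I" if "{u, v} \<in> edges I" for u v
    using inv(1) that by (auto simp: simple_graph_def)
  then show ?thesis
    using inv unfolding valid_instance_def by blast
qed

section \<open>The matching along a growing instance\<close>

lemma matching_after_subset: "matching_after p I n \<subseteq> edges I"
  using matching_matching_after[of I p n] by (simp add: matching_def)

lemma finite_final_matching: "online_prefix I \<Longrightarrow> finite (final_matching p I)"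
  unfolding final_matching_def
  by (rule finite_subset[OF matching_after_subset online_prefix_finite(2)])

lemma Union_final_matching_subset: "online_prefix I \<Longrightarrow> \<Union>(final_matching p I) \<subseteq> verts I"
  unfolding final_matching_def
  by (rule Union_least) (meson matching_after_subset online_prefix_finite(3) subsetD)

lemma matching_after_expire:
  "n \<le> length (timeline I) \<Longrightarrow> matching_after p (expire v I) n = matching_after p I n"
proof (induction n)
  case (Suc n)
  have "history (expire v I) (Suc n) = history I (Suc n)"
    using Suc.prems by (auto simp: history_def observe_def nth_append split: event.split)
  then show ?case
    using Suc by (simp add: nth_append Let_def split: event.split option.split)
qed simp

text \<open>Online behaviour in the form needed by the adversary: extending the instance cannot
  change past decisions. A past observation lists only neighbours that had already arrived, hence
  never \<open>v\<close>, and an admissibility test at a past deadline concerns an expired vertex,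
  which lies on no new edge.\<close>

lemma matching_after_arrive:
  assumes I: "online_prefix I" and v: "v \<notin> verts I" and N: "N \<subseteq> verts I - expired I"
  shows "n \<le> length (timeline I) \<Longrightarrow> matching_after p (arrive N v I) n = matching_after p I n"
proof (induction n)
  case (Suc n)
  note inv = online_prefix_invariants[OF I]
  have observe: "observe (arrive N v I) i = observe I i" if i: "i < length (timeline I)" for i
  proof -
    have "timeline I ! i \<in> set (timeline I)" using i by simp
    then have nv: "timeline I ! i \<noteq> Arrival v" using inv(3) v by auto
    have "Arrival v \<notin> set (take i (timeline I))"
      using inv(3) v by (auto dest!: in_set_takeD)
    then have "{u, w} \<notin> (\<lambda>u. {u, v}) ` N"
      if "w \<noteq> v" "Arrival u \<in> set (take i (timeline I))" for u w
      using that by (auto simp: doubleton_eq_iff)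
    then show ?thesis
      using i nv by (cases "timeline I ! i") (auto simp: observe_def nth_append)
  qed
  then have hist: "history (arrive N v I) (Suc n) = history I (Suc n)"
    using Suc.prems by (auto simp: history_def)
  have edge: "{u, w} \<in> edges (arrive N v I) \<longleftrightarrow> {u, w} \<in> edges I"
    if "timeline I ! n = Deadline w" for u w
  proof -
    have "Deadline w \<in> set (timeline I)"
      using that Suc.prems by (metis Suc_le_eq nth_mem)
    then have "w \<in> expired I" by (simp add: expired_def)
    then show ?thesis
      using inv(4) v N by (auto simp: doubleton_eq_iff)
  qed
  show ?case
    using Suc hist edge by (auto simp: nth_append Let_def split: event.split option.split)
qed simp

lemma final_matching_arrive:
  "\<lbrakk>online_prefix I; v \<notin> verts I; N \<subseteq> verts I - expired I\<rbrakk>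
    \<Longrightarrow> final_matching p (arrive N v I) = final_matching p I"
  by (simp add: final_matching_def matching_after_arrive nth_append)

lemma final_matching_fold_arrive:
  "\<lbrakk>online_prefix I; distinct ws; set ws \<inter> verts I = {}; N \<subseteq> verts I - expired I\<rbrakk>
    \<Longrightarrow> final_matching p (fold (arrive N) ws I) = final_matching p I"
proof (induction ws arbitrary: I)
  case (Cons w ws)
  have "final_matching p (fold (arrive N) ws (arrive N w I)) = final_matching p (arrive N w I)"
    using Cons.prems by (intro Cons.IH online_prefix.arrive) auto
  then show ?case
    using Cons.prems by (simp add: final_matching_arrive)
qed simp

lemma final_matching_expire:
  obtains "final_matching p (expire v I) = final_matching p I"
  | u where "final_matching p (expire v I) = insert {u, v} (final_matching p I)"
      "{u, v} \<in> edges I" "u \<notin> expired I"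
      "u \<notin> \<Union>(final_matching p I)" "v \<notin> \<Union>(final_matching p I)"
proof -
  let ?M = "final_matching p I"
  have "final_matching p (expire v I) = ?M \<or>
      (\<exists>u. final_matching p (expire v I) = insert {u, v} ?M \<and> {u, v} \<in> edges I \<and> u \<notin> expired I \<and>
        u \<notin> \<Union>?M \<and> v \<notin> \<Union>?M)"
    by (auto simp: final_matching_def matching_after_expire Let_def expired_def split: option.split)
  then show thesis using that by blast
qed

text \<open>The pathwise core. Every edge added during these deadlines joins a free vertex of
  \<open>vs\<close> to a free vertex of \<open>X\<close>, because an admissible partner has not
  expired. Hence each new edge uses up exactly one free vertex of \<open>X\<close>, and the number
  of new edges is at most the number of free vertices of \<open>vs\<close>.\<close>

lemma final_matching_fold_expire:
  fixes p :: policy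
  assumes "online_prefix I" "distinct vs" "set vs \<subseteq> verts I - expired I"
    and "finite X" "X \<inter> set vs = {}"
    and "\<forall>v\<in>set vs. \<forall>u. {u, v} \<in> edges I \<longrightarrow> u \<in> expired I \<union> X"
  defines "M \<equiv> final_matching p I" and "M' \<equiv> final_matching p (fold expire vs I)"
  shows "card M' + card (X - \<Union>M') = card M + card (X - \<Union>M)"
    and "card M' \<le> card M + card (set vs - \<Union>M)"
proof -
  have "card M' + card (X - \<Union>M') = card M + card (X - \<Union>M) \<and>
        card M' \<le> card M + card (set vs - \<Union>M)"
    using assms(1-6) unfolding M_def M'_def
  proof (induction vs arbitrary: I)
    case Nil
    then show ?case by simp
  next
    case (Cons v vs)
    define M where "M = final_matching p I"
    define M1 where "M1 = final_matching p (expire v I)"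
    define M' where "M' = final_matching p (fold expire vs (expire v I))"
    have fin: "finite M" using Cons.prems(1) by (simp add: M_def finite_final_matching)
    have IH: "card M' + card (X - \<Union>M') = card M1 + card (X - \<Union>M1) \<and>
        card M' \<le> card M1 + card (set vs - \<Union>M1)"
      unfolding M'_def M1_def
      using Cons.prems by (intro Cons.IH online_prefix.expire) auto
    \<comment> \<open>For a single deadline the \<open>X\<close>-sum is conserved. The sum over the
      vertices still to expire may drop: this happens when a free \<open>v\<close> is left
      unmatched.\<close>
    have "card M1 + card (X - \<Union>M1) = card M + card (X - \<Union>M) \<and>
        card M1 + card (set vs - \<Union>M1) \<le> card M + card (set (v # vs) - \<Union>M)"
    proof (rule final_matching_expire[of p v I])
      assume "final_matching p (expire v I) = final_matching p I"
      then show ?thesis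
        by (auto simp: M1_def M_def intro!: card_mono)
    next
      fix u
      assume M1: "final_matching p (expire v I) = insert {u, v} (final_matching p I)"
        and u: "{u, v} \<in> edges I" "u \<notin> expired I"
        and free: "u \<notin> \<Union>(final_matching p I)" "v \<notin> \<Union>(final_matching p I)"
      have uX: "u \<in> X" using Cons.prems(6) u by auto
      have "card M1 = Suc (card M)"
      proof -
        have "{u, v} \<notin> M" using free by (auto simp: M_def)
        then show ?thesis using fin by (simp add: M1_def M1 M_def[symmetric])
      qed
      moreover have "X - \<Union>M1 = (X - \<Union>M) - {u}"
        using Cons.prems(5) by (auto simp: M1_def M1 M_def)
      then have "Suc (card (X - \<Union>M1)) = card (X - \<Union>M)"
        using uX free Cons.prems(4) by (simp add: M_def card_Suc_Diff1 del: card_Diff_insert)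
      moreover have "set (v # vs) - \<Union>M = insert v (set vs - \<Union>M)"
        using free by (auto simp: M_def)
      then have "card (set (v # vs) - \<Union>M) = Suc (card (set vs - \<Union>M))"
        using Cons.prems(2) by simp
      moreover have "card (set vs - \<Union>M1) \<le> card (set vs - \<Union>M)"
        by (auto simp: M1_def M1 M_def intro!: card_mono)
      ultimately show ?thesis by simp
    qed
    then show ?case using IH by (simp add: M_def M'_def)
  qed
  then show "card M' + card (X - \<Union>M') = card M + card (X - \<Union>M)"
    and "card M' \<le> card M + card (set vs - \<Union>M)"
    by blast+
qed

section \<open>Stages of the hard instance\<close>

text \<open>
  \<open>S\<close> holds the live vertices, whose optimal partner has not been decided yet; \<open>m\<close> edges of the
  optimal matching are already fixed among the others.
\<close>

definition stage :: "fom_instance \<Rightarrow> nat set \<Rightarrow> nat \<Rightarrow> bool" where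
  "stage I S m \<longleftrightarrow>
     online_prefix I \<and> S \<subseteq> verts I - expired I \<and> (\<forall>e\<in>edges I. e \<inter> expired I \<noteq> {}) \<and>
     (\<exists>L R. L \<union> R = verts I \<and> L \<inter> R = {} \<and> S \<subseteq> L \<and> (\<forall>e\<in>edges I. \<exists>l\<in>L. \<exists>r\<in>R. e = {l, r})) \<and>
     (\<exists>M. matching (edges I) M \<and> card M = m \<and> finite M \<and> \<Union>M \<inter> S = {})"

lemma stage_finite: "stage I S m \<Longrightarrow> finite S"
  unfolding stage_def by (meson Diff_subset finite_subset online_prefix_finite(1))

lemma stage_init: "\<exists>I S. stage I S 0 \<and> card S = k \<and> (\<forall>p. final_matching p I = {})"
proof (intro exI conjI allI)
  define I where "I = fold (arrive {}) [0..<k] (Fom_Instance {} {} [])"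
  have I: "online_prefix I"
    unfolding I_def by (intro online_prefix_fold_arrive online_prefix.empty) auto
  have "verts I = {0..<k}" "edges I = {}" "expired I = {}"
    by (simp_all add: I_def) (simp add: expired_def)
  then show "stage I {0..<k} 0"
    using I unfolding stage_def matching_def by auto
  show "final_matching p I = {}" for p
    using final_matching_fold_arrive[of "Fom_Instance {} {} []" "[0..<k]" "{}" p]
    by (simp add: I_def online_prefix.empty final_matching_def)
qed simp

text \<open>The first move. It is written with one-element folds so that the fold lemmas cover both
  moves.\<close>

definition serve :: "nat set \<Rightarrow> nat \<Rightarrow> fom_instance \<Rightarrow> fom_instance" where
  "serve S u I = fold expire [u] (fold (arrive S) [u] I)"

text \<open>The second move. Sorting merely fixes some order of the deadlines.\<close>

definition replace_live :: "nat set \<Rightarrow> nat list \<Rightarrow> fom_instance \<Rightarrow> fom_instance" where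
  "replace_live S ws I = fold expire (sorted_list_of_set S) (fold (arrive S) ws I)"

lemma matching_insert:
  "matching E M \<Longrightarrow> e \<in> E \<Longrightarrow> e \<inter> \<Union>M = {} \<Longrightarrow> matching E (insert e M)"
  by (auto simp: matching_def pairwise_insert disjnt_def)

text \<open>Any live \<open>d\<close> can be declared the optimal partner of \<open>u\<close>. The
  instance itself does not depend on \<open>d\<close>, so \<open>d\<close> may be chosen according
  to the distribution of the matching after the move.\<close>

lemma stage_serve:
  assumes st: "stage I S m" and u: "u \<notin> verts I" and d: "d \<in> S"
  shows "stage (serve S u I) (S - {d}) (Suc m)"
proof -
  have I: "online_prefix I" and S: "S \<subseteq> verts I - expired I"
    and ex: "\<forall>e\<in>edges I. e \<inter> expired I \<noteq> {}"
    using st by (auto simp: stage_def)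
  obtain L R where LR: "L \<union> R = verts I" "L \<inter> R = {}" "S \<subseteq> L"
      "\<forall>e\<in>edges I. \<exists>l\<in>L. \<exists>r\<in>R. e = {l, r}"
    using st by (auto simp: stage_def)
  obtain M where M: "matching (edges I) M" "card M = m" "finite M" "\<Union>M \<inter> S = {}"
    using st by (auto simp: stage_def)
  let ?I = "serve S u I"
  have edges: "edges ?I = edges I \<union> {{v, u} |v. v \<in> S}"
    and verts: "verts ?I = insert u (verts I)" and expired: "expired ?I = insert u (expired I)"
    by (auto simp: serve_def)
  have "online_prefix ?I"
    unfolding serve_def
    using I u S online_prefix_invariants(4)[OF I]
    by (intro online_prefix_fold_expire online_prefix_fold_arrive) auto
  moreover have "S - {d} \<subseteq> verts ?I - expired ?I"
    using S u by (auto simp: verts expired)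
  moreover have "\<forall>e\<in>edges ?I. e \<inter> expired ?I \<noteq> {}"
    using ex by (auto simp: edges expired)
  moreover have "\<exists>L R. L \<union> R = verts ?I \<and> L \<inter> R = {} \<and> S - {d} \<subseteq> L \<and>
      (\<forall>e\<in>edges ?I. \<exists>l\<in>L. \<exists>r\<in>R. e = {l, r})"
  proof -
    have "\<exists>l\<in>L. \<exists>r\<in>insert u R. e = {l, r}" if "e \<in> edges ?I" for e
      using that LR(3,4) unfolding edges by fastforce
    then show ?thesis
      using LR u by (intro exI[of _ L] exI[of _ "insert u R"]) (auto simp: verts)
  qed
  moreover have "\<exists>M. matching (edges ?I) M \<and> card M = Suc m \<and> finite M \<and>
      \<Union>M \<inter> (S - {d}) = {}"
  proof -
    have UM: "\<Union>M \<subseteq> verts I"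
      using M(1) online_prefix_finite(3)[OF I] by (auto simp: matching_def)
    then have disj: "{d, u} \<inter> \<Union>M = {}" using M(4) d u by auto
    then have "{d, u} \<notin> M" by auto
    moreover have "matching (edges ?I) M" using M(1) by (auto simp: matching_def edges)
    ultimately show ?thesis
      using M S u d disj
      by (intro exI[of _ "insert {d, u} M"]) (auto intro!: matching_insert simp: edges)
  qed
  ultimately show ?thesis unfolding stage_def by (intro conjI)
qed

text \<open>Any \<open>card S\<close> of the new vertices can serve as optimal partners of
  \<open>S\<close>, since the new edges form a complete bipartite graph. Again the choice of
  \<open>D\<close> does not influence the instance.\<close>

lemma stage_replace_live:
  assumes st: "stage I S m" and ws: "distinct ws" "set ws \<inter> verts I = {}"
    and D: "D \<subseteq> set ws" "card D = card S"
  shows "stage (replace_live S ws I) (set ws - D) (m + card S)"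
proof -
  have I: "online_prefix I" and S: "S \<subseteq> verts I - expired I"
    and ex: "\<forall>e\<in>edges I. e \<inter> expired I \<noteq> {}"
    using st by (auto simp: stage_def)
  obtain L R where LR: "L \<union> R = verts I" "L \<inter> R = {}" "S \<subseteq> L"
      "\<forall>e\<in>edges I. \<exists>l\<in>L. \<exists>r\<in>R. e = {l, r}"
    using st by (auto simp: stage_def)
  obtain M where M: "matching (edges I) M" "card M = m" "finite M" "\<Union>M \<inter> S = {}"
    using st by (auto simp: stage_def)
  have finS: "finite S" using st by (rule stage_finite)
  let ?I = "replace_live S ws I"
  have edges: "edges ?I = edges I \<union> {{u, w} |u w. u \<in> S \<and> w \<in> set ws}"
    and verts: "verts ?I = verts I \<union> set ws" and expired: "expired ?I = expired I \<union> S"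
    using finS by (auto simp: replace_live_def)
  have exV: "expired I \<subseteq> verts I" using online_prefix_invariants(4)[OF I] .
  have "online_prefix ?I"
    unfolding replace_live_def
    using I ws S finS by (intro online_prefix_fold_expire online_prefix_fold_arrive) auto
  moreover have "set ws - D \<subseteq> verts ?I - expired ?I"
    using S ws exV by (auto simp: verts expired)
  moreover have "\<forall>e\<in>edges ?I. e \<inter> expired ?I \<noteq> {}"
    using ex by (auto simp: edges expired)
  moreover have "\<exists>L R. L \<union> R = verts ?I \<and> L \<inter> R = {} \<and> set ws - D \<subseteq> L \<and>
      (\<forall>e\<in>edges ?I. \<exists>l\<in>L. \<exists>r\<in>R. e = {l, r})"
  proof -
    have "\<exists>l\<in>R \<union> set ws. \<exists>r\<in>L. e = {l, r}" if "e \<in> edges ?I" for e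
      using that LR(3,4) unfolding edges by (fastforce simp: insert_commute)
    then show ?thesis
      \<comment> \<open>The two sides swap roles: the new live vertices lie opposite to
        \<open>S\<close>.\<close>
      using LR ws by (intro exI[of _ "R \<union> set ws"] exI[of _ L]) (auto simp: verts)
  qed
  moreover have "\<exists>M'. matching (edges ?I) M' \<and> card M' = m + card S \<and> finite M' \<and>
      \<Union>M' \<inter> (set ws - D) = {}"
  proof -
    have finD: "finite D" using D finite_subset by blast
    obtain f where f: "bij_betw f S D"
      using finite_same_card_bij[OF finS finD] D by auto
    then have fS: "f ` S = D" and inj: "inj_on f S" by (auto simp: bij_betw_def)
    have UM: "\<Union>M \<subseteq> verts I"
      using M(1) online_prefix_finite(3)[OF I] by (auto simp: matching_def)
    \<comment> \<open>The optimal edges \<open>{v, f v}\<close> are added one at a time, so that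
      disjointness and the exact count are obtained together.\<close>
    have "matching (edges ?I) (M \<union> (\<lambda>v. {v, f v}) ` T) \<and>
        card (M \<union> (\<lambda>v. {v, f v}) ` T) = m + card T" if "T \<subseteq> S" for T
      using finite_subset[OF that finS] that
    proof (induction T)
      case empty
      then show ?case using M by (auto simp: matching_def edges)
    next
      case (insert v T)
      let ?M = "M \<union> (\<lambda>v. {v, f v}) ` T"
      have v: "v \<in> S" "v \<notin> T" "f v \<in> D" "f v \<notin> verts I" and "T \<subseteq> S"
        using insert fS D ws by auto
      have "f v \<notin> f ` T"
        using v \<open>T \<subseteq> S\<close> inj by (meson inj_on_image_mem_iff)
      moreover have "v \<notin> D" "D \<inter> S = {}" using v S D ws by auto
      then have "v \<notin> f ` T" "f v \<notin> T" using fS v(3) \<open>T \<subseteq> S\<close> by auto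
      moreover have "v \<notin> \<Union>M" "f v \<notin> \<Union>M" using v UM M(4) by auto
      ultimately have disj: "{v, f v} \<inter> \<Union>?M = {}"
        using v(2) by auto
      then have "{v, f v} \<notin> ?M" by auto
      moreover have "{v, f v} \<in> edges ?I" using v D by (auto simp: edges)
      moreover have "M \<union> (\<lambda>v. {v, f v}) ` insert v T = insert {v, f v} ?M" by auto
      ultimately show ?case
        using insert disj M(3) by (simp add: matching_insert)
    qed
    from this[of S] have *: "matching (edges ?I) (M \<union> (\<lambda>v. {v, f v}) ` S)"
      "card (M \<union> (\<lambda>v. {v, f v}) ` S) = m + card S" by auto
    moreover have "\<Union>(M \<union> (\<lambda>v. {v, f v}) ` S) \<inter> (set ws - D) = {}"
      using UM ws S fS by auto
    ultimately show ?thesis using M(3) finS by blast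
  qed
  ultimately show ?thesis unfolding stage_def by (intro conjI)
qed

lemma OPT_ge:
  assumes "finite (edges I)" "matching (edges I) M"
  shows "card M \<le> OPT I"
  unfolding OPT_def max_matching_size_def
proof (rule Max_ge)
  have "{M. matching (edges I) M} \<subseteq> Pow (edges I)" by (auto simp: matching_def)
  then show "finite (card ` {M. matching (edges I) M})"
    using assms(1) by (meson finite_Pow_iff finite_imageI finite_subset)
qed (use assms in auto)

text \<open>A vertex meeting its deadline here has only expired neighbours, so no partner is
  admissible.\<close>

lemma final_matching_fold_expire_idle:
  "\<lbrakk>\<forall>e\<in>edges I. e \<inter> expired I \<noteq> {}; distinct vs; set vs \<inter> expired I = {}\<rbrakk>
    \<Longrightarrow> final_matching p (fold expire vs I) = final_matching p I"
proof (induction vs arbitrary: I)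
  case (Cons v vs)
  have "final_matching p (fold expire vs (expire v I)) = final_matching p (expire v I)"
    using Cons.prems by (intro Cons.IH) auto
  also have "\<dots> = final_matching p I"
    using Cons.prems by (rule_tac final_matching_expire[of p v I]) auto
  finally show ?case by simp
qed simp

text \<open>Outstanding deadlines can be appended at the end: by the preceding fact they change no
  matching, and they turn the prefix into a valid instance.\<close>

lemma stage_complete:
  assumes "stage I S m"
  obtains J where "valid_instance J" "bipartite (verts J) (edges J)" "m \<le> OPT J"
    "\<And>p. final_matching p J = final_matching p I"
proof
  have I: "online_prefix I" and ex: "\<forall>e\<in>edges I. e \<inter> expired I \<noteq> {}"
    and bip: "bipartite (verts I) (edges I)"
    using assms by (auto simp: stage_def bipartite_def)
  define vs where "vs = sorted_list_of_set (verts I - expired I)"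
  have vs: "set vs = verts I - expired I" "distinct vs"
    using online_prefix_finite(1)[OF I] by (auto simp: vs_def)
  let ?J = "fold expire vs I"
  have J: "online_prefix ?J" using I vs by (intro online_prefix_fold_expire) auto
  then show "valid_instance ?J"
    using vs online_prefix_invariants(4)[OF I] by (intro valid_instanceI) auto
  show "bipartite (verts ?J) (edges ?J)" using bip by simp
  show "m \<le> OPT ?J"
    using assms OPT_ge[OF online_prefix_finite(2)[OF J]] by (auto simp: stage_def)
  show "final_matching p ?J = final_matching p I" for p
    using ex vs by (intro final_matching_fold_expire_idle) auto
qed

section \<open>Expected sizes against a fixed randomized algorithm\<close>

locale randomized_fom =
  fixes W :: "'w measure" and A :: "'w \<Rightarrow> policy"
  assumes algorithm: "randomized_algorithm W A"
begin

sublocale prob_space W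
  using algorithm by (simp add: randomized_algorithm_def)

definition exposed :: "fom_instance \<Rightarrow> nat set \<Rightarrow> real" where
  "exposed I S = (\<integral>\<omega>. real (card (S - \<Union>(final_matching (A \<omega>) I))) \<partial>W)"

section \<open>Measurability, integrability and averaging over the live vertices\<close>

lemma measurable_matching_after:
  "(\<lambda>\<omega>. matching_after (A \<omega>) I n) \<in> measurable W (count_space UNIV)"
proof (induction n)
  case (Suc n)
  have A: "(\<lambda>\<omega>. A \<omega> h) \<in> measurable W (count_space UNIV)" for h
    using algorithm unfolding randomized_algorithm_def by blast
  \<comment> \<open>\<open>F\<close> separates the old matching from the answer \<open>c\<close>.
    The countable composition rule splits over \<open>c\<close>, whose type is countable; the type
    of matchings is not.\<close>
  define F where "F M c = (case timeline I ! n of Arrival v \<Rightarrow> M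
      | Deadline v \<Rightarrow> if v \<in> \<Union>M then M else (case c of None \<Rightarrow> M
          | Some u \<Rightarrow> if {u, v} \<in> edges I \<and> u \<notin> \<Union>M \<and> Deadline u \<notin> set (take n (timeline I))
              then insert {u, v} M else M))" for M and c :: "nat option"
  have "(\<lambda>\<omega>. F (matching_after (A \<omega>) I n) (A \<omega> (history I (Suc n))))
      \<in> measurable W (count_space UNIV)"
    by (rule measurable_compose_countable[OF _ A])
      (rule measurable_compose[OF Suc.IH], simp)
  then show ?case by (simp add: F_def Let_def)
qed simp

text \<open>All values of the matching lie in the finite set \<open>Pow (edges I)\<close>, so any
  real function of it is bounded.\<close>

lemma integrable_final_matching:
  fixes f :: "nat set set \<Rightarrow> real"
  assumes "finite (edges I)"
  shows "integrable W (\<lambda>\<omega>. f (final_matching (A \<omega>) I))"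
proof (rule integrable_const_bound)
  let ?B = "Max ((\<lambda>M. \<bar>f M\<bar>) ` Pow (edges I))"
  have "\<bar>f (final_matching (A \<omega>) I)\<bar> \<le> ?B" for \<omega>
    using assms matching_after_subset by (intro Max_ge) (auto simp: final_matching_def)
  then show "AE \<omega> in W. norm (f (final_matching (A \<omega>) I)) \<le> ?B" by simp
  show "(\<lambda>\<omega>. f (final_matching (A \<omega>) I)) \<in> borel_measurable W"
    unfolding final_matching_def
    using measurable_compose[OF measurable_matching_after, of f] by simp
qed

text \<open>By linearity of expectation \<open>exposed\<close> is additive over vertices, so the
  vertex most likely to be unmatched carries at least the average share. Only the distribution is
  consulted, which an oblivious adversary may do.\<close>

lemma remove_most_exposed:
  assumes "finite (edges I)" "finite S" "S \<noteq> {}"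
  obtains d where "d \<in> S" "real (card S) * exposed I (S - {d}) \<le> real (card S - 1) * exposed I S"
proof -
  let ?q = "\<lambda>v. exposed I {v}"
  have exposed_sum: "exposed I T = sum ?q T" if "finite T" for T
  proof -
    have "real (card (T - \<Union>M)) = (\<Sum>v\<in>T. real (card ({v} - \<Union>M)))" for M :: "nat set set"
      using that by induction (auto simp: insert_Diff_if)
    then show ?thesis
      unfolding exposed_def
      using Bochner_Integration.integral_sum[OF integrable_final_matching[OF assms(1),
          where f = "\<lambda>M. real (card ({_} - \<Union>M))"]]
      by simp
  qed
  obtain d where d: "d \<in> S" "\<forall>v\<in>S. ?q v \<le> ?q d"
  proof -
    have "Max (?q ` S) \<in> ?q ` S" using assms by (intro Max_in) auto
    then obtain d where "d \<in> S" "Max (?q ` S) = ?q d" by blast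
    moreover have "?q v \<le> Max (?q ` S)" if "v \<in> S" for v
      using that assms by (intro Max_ge) auto
    ultimately show ?thesis using that by metis
  qed
  have "sum ?q S \<le> real (card S) * ?q d"
    using d by (intro sum_bounded_above) auto
  moreover have "sum ?q S = ?q d + sum ?q (S - {d})"
    using d assms by (simp add: sum.remove)
  moreover have "real (card S - 1) = real (card S) - 1"
    using d assms by (simp add: Suc_leI card_gt_0_iff of_nat_diff)
  ultimately have "real (card S) * exposed I (S - {d}) \<le> real (card S - 1) * exposed I S"
    using exposed_sum[of S] exposed_sum[of "S - {d}"] assms(2) by (simp add: algebra_simps)
  then show thesis using d(1) that by blast
qed

lemma remove_most_exposed_set:
  assumes "finite (edges I)" "finite S" "k \<le> card S"
  obtains D where "D \<subseteq> S" "card D = k"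
    "real (card S) * exposed I (S - D) \<le> real (card S - k) * exposed I S"
proof -
  have "\<exists>D\<subseteq>S. card D = k \<and> real (card S) * exposed I (S - D) \<le> real (card S - k) * exposed I S"
    using assms(3)
  proof (induction k)
    case 0
    then show ?case by auto
  next
    case (Suc k)
    then obtain D where D: "D \<subseteq> S" "card D = k"
      and le: "real (card S) * exposed I (S - D) \<le> real (card S - k) * exposed I S" by auto
    have finD: "finite D" using D assms finite_subset by blast
    have card: "card (S - D) = card S - k" using D finD by (simp add: card_Diff_subset)
    then have ne: "S - D \<noteq> {}" using Suc.prems by force
    obtain d where d: "d \<in> S - D"
      and le': "real (card (S - D)) * exposed I (S - D - {d})
                  \<le> real (card (S - D) - 1) * exposed I (S - D)"
      by (rule remove_most_exposed[OF assms(1) finite_Diff[OF assms(2)] ne])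
    have pos: "0 < real (card S - k)" using Suc.prems by simp
    \<comment> \<open>The factors \<open>(s - i - 1) / (s - i)\<close> of successive removals, with
      \<open>s = card S\<close>, telescope to \<open>(s - k) / s\<close>. The induction step is
      multiplied by the positive \<open>card S - k\<close>, which is cancelled at the end.\<close>
    have "real (card S - k) * (real (card S) * exposed I (S - insert d D))
        = real (card S) * (real (card (S - D)) * exposed I (S - D - {d}))"
      by (simp add: card Diff_insert[of S d D])
    also have "\<dots> \<le> real (card S) * (real (card S - Suc k) * exposed I (S - D))"
      using le' by (intro mult_left_mono) (simp_all add: card)
    also have "\<dots> \<le> real (card S - Suc k) * (real (card S - k) * exposed I S)"
      using mult_left_mono[OF le, of "real (card S - Suc k)"] by (simp add: algebra_simps)
    finally have "real (card S) * exposed I (S - insert d D) \<le> real (card S - Suc k) * exposed I S"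
      using pos by (simp add: mult.left_commute)
    then show ?case
      using d D finD by (intro exI[of _ "insert d D"]) auto
  qed
  then show thesis using that by blast
qed

abbreviation gain :: "fom_instance \<Rightarrow> real" where
  "gain \<equiv> expected_size W A"

section \<open>Expected effect of the two moves\<close>

lemma gain_plus_exposed:
  assumes "finite (edges I)"
  shows "gain I + exposed I S =
    (\<integral>\<omega>. real (card (final_matching (A \<omega>) I) + card (S - \<Union>(final_matching (A \<omega>) I))) \<partial>W)"
  unfolding expected_size_def exposed_def of_nat_add
  by (rule Bochner_Integration.integral_add[symmetric])
    (rule integrable_final_matching[OF assms])+

lemma fold_expire_expectation:
  assumes I: "online_prefix I" and vs: "distinct vs" "set vs \<subseteq> verts I - expired I"
    and X: "finite X" "X \<inter> set vs = {}"
      "\<forall>v\<in>set vs. \<forall>u. {u, v} \<in> edges I \<longrightarrow> u \<in> expired I \<union> X"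
  shows "gain (fold expire vs I) + exposed (fold expire vs I) X = gain I + exposed I X"
    and "gain (fold expire vs I) \<le> gain I + exposed I (set vs)"
proof -
  note fin = online_prefix_finite(2)[OF I]
  have fin': "finite (edges (fold expire vs I))" using fin by simp
  note pathwise = final_matching_fold_expire[OF I vs X]
  show "gain (fold expire vs I) + exposed (fold expire vs I) X = gain I + exposed I X"
    unfolding gain_plus_exposed[OF fin] gain_plus_exposed[OF fin'] pathwise(1) ..
  show "gain (fold expire vs I) \<le> gain I + exposed I (set vs)"
  proof -
    have "gain (fold expire vs I)
        \<le> (\<integral>\<omega>. real (card (final_matching (A \<omega>) I) + card (set vs - \<Union>(final_matching (A \<omega>) I))) \<partial>W)"
      unfolding expected_size_def
      by (intro integral_mono integrable_final_matching fin'
          integrable_final_matching[OF fin, where f = "\<lambda>M. real (card M + card (set vs - \<Union>M))"]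
          of_nat_mono pathwise(2))
    then show ?thesis unfolding gain_plus_exposed[OF fin] .
  qed
qed

lemma exposed_le_card:
  assumes "online_prefix I" "finite S"
  shows "exposed I S \<le> real (card S)"
  unfolding exposed_def
  using assms online_prefix_finite(2)
  by (intro integral_le_const integrable_final_matching[where f = "\<lambda>M. real (card (S - \<Union>M))"])
    (auto intro!: card_mono)

lemma exposed_eq_card:
  assumes "\<And>p. S \<inter> \<Union>(final_matching p I) = {}"
  shows "exposed I S = real (card S)"
proof -
  have "S - \<Union>(final_matching p I) = S" for p using assms[of p] by blast
  then show ?thesis by (simp add: exposed_def prob_space)
qed

text \<open>The pathwise core with \<open>X = S\<close>, since all neighbours of \<open>u\<close>
  are in \<open>S\<close>; a single deadline adds at most one edge.\<close>

lemma serve_expectation: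
  assumes st: "stage I S m" and u: "u \<notin> verts I"
  shows "gain (serve S u I) + exposed (serve S u I) S = gain I + exposed I S"
    and "gain (serve S u I) \<le> gain I + 1"
proof -
  have I: "online_prefix I" and S: "S \<subseteq> verts I - expired I"
    using st by (auto simp: stage_def)
  let ?J = "fold (arrive S) [u] I"
  have J: "online_prefix ?J"
    using I u S by (intro online_prefix_fold_arrive) auto
  have uX: "u \<notin> expired I" "\<And>e. e \<in> edges I \<Longrightarrow> u \<notin> e"
    using u online_prefix_invariants(4)[OF I] online_prefix_finite(3)[OF I] by auto
  have "final_matching p ?J = final_matching p I" for p
    using I u S by (intro final_matching_fold_arrive) auto
  then have eq: "gain ?J = gain I" "exposed ?J T = exposed I T" for T
    by (simp_all add: expected_size_def exposed_def)
  have *: "distinct [u]" "set [u] \<subseteq> verts ?J - expired ?J" "finite S" "S \<inter> set [u] = {}"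
    "\<forall>v\<in>set [u]. \<forall>w. {w, v} \<in> edges ?J \<longrightarrow> w \<in> expired ?J \<union> S"
    using u S uX stage_finite[OF st] by (auto simp: doubleton_eq_iff)
  show "gain (serve S u I) + exposed (serve S u I) S = gain I + exposed I S"
    using fold_expire_expectation(1)[OF J *] by (simp only: serve_def eq)
  have "gain (serve S u I) \<le> gain I + exposed I (set [u])"
    using fold_expire_expectation(2)[OF J *] by (simp only: serve_def eq)
  also have "exposed I (set [u]) \<le> 1"
    using exposed_le_card[OF I, of "{u}"] by simp
  finally show "gain (serve S u I) \<le> gain I + 1" by simp
qed

text \<open>The pathwise core with \<open>S\<close> expiring and \<open>X = set ws\<close>, whose
  vertices are all free beforehand. The second bound is the source of the improvement: only live
  vertices that are still unmatched can add edges.\<close>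

lemma replace_live_expectation:
  assumes st: "stage I S m" and ws: "distinct ws" "set ws \<inter> verts I = {}"
  shows "gain (replace_live S ws I) + exposed (replace_live S ws I) (set ws)
           = gain I + real (length ws)"
    and "gain (replace_live S ws I) \<le> gain I + exposed I S"
proof -
  have I: "online_prefix I" and S: "S \<subseteq> verts I - expired I"
    and ex: "\<forall>e\<in>edges I. e \<inter> expired I \<noteq> {}"
    using st by (auto simp: stage_def)
  let ?J = "fold (arrive S) ws I"
  let ?vs = "sorted_list_of_set S"
  have J: "online_prefix ?J"
    using I ws S by (intro online_prefix_fold_arrive) auto
  have fm: "final_matching p ?J = final_matching p I" for p
    using I ws S by (intro final_matching_fold_arrive) auto
  then have eq: "gain ?J = gain I" "exposed ?J T = exposed I T" for T
    by (simp_all add: expected_size_def exposed_def)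
  have wsI: "exposed I (set ws) = real (length ws)"
    using exposed_eq_card[of "set ws" I] Union_final_matching_subset[OF I] ws
    by (fastforce simp: distinct_card)
  have *: "distinct ?vs" "set ?vs \<subseteq> verts ?J - expired ?J" "finite (set ws)" "set ws \<inter> set ?vs = {}"
    "\<forall>v\<in>set ?vs. \<forall>u. {u, v} \<in> edges ?J \<longrightarrow> u \<in> expired ?J \<union> set ws"
    using ws S ex stage_finite[OF st] by (auto simp: doubleton_eq_iff)
  show "gain (replace_live S ws I) + exposed (replace_live S ws I) (set ws)
           = gain I + real (length ws)"
    using fold_expire_expectation(1)[OF J *] by (simp only: replace_live_def eq wsI)
  show "gain (replace_live S ws I) \<le> gain I + exposed I S"
    using fold_expire_expectation(2)[OF J *] stage_finite[OF st]
    by (simp only: replace_live_def eq set_sorted_list_of_set)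
qed

section \<open>Potential inequalities for moves and phases\<close>

lemma fresh_vertices:
  assumes "finite V"
  obtains ws :: "nat list" where "distinct ws" "set ws \<inter> V = {}" "length ws = k"
proof -
  have "infinite (- V)" using assms by (simp add: Compl_eq_Diff_UNIV)
  then obtain B where B: "finite B" "card B = k" "B \<subseteq> - V"
    using infinite_arbitrarily_large by metis
  then show thesis
    using that[of "sorted_list_of_set B"] by auto
qed

text \<open>Retiring the most exposed vertex turns weight \<open>c\<close> into
  \<open>a = c * k / (k + 1)\<close> on all of \<open>S\<close>. The potential is then the convex
  combination, with weights \<open>1 - a\<close> and \<open>a\<close>, of \<open>gain\<close> and
  \<open>gain + exposed\<close>; the former grows by at most 1 and the latter is conserved. The
  upper bound on \<open>c\<close> ensures \<open>a \<le> 1\<close>.\<close>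

lemma serve_step:
  assumes st: "stage I S m" and card: "card S = Suc k" and c: "0 \<le> c" "c * real k \<le> real (Suc k)"
  shows "\<exists>J T. stage J T (Suc m) \<and> card T = k \<and>
    gain J + c * exposed J T
      \<le> gain I + c * real k / real (Suc k) * exposed I S + (1 - c * real k / real (Suc k))"
proof -
  have "finite (verts I)" using st online_prefix_finite by (auto simp: stage_def)
  then obtain u where u: "u \<notin> verts I" using infinite_UNIV_nat ex_new_if_finite by blast
  let ?J = "serve S u I"
  define a where "a = c * real k / real (Suc k)"
  have a: "a \<le> 1" "0 \<le> a" using c by (simp_all add: a_def)
  have fin: "finite S" "S \<noteq> {}" using card by (auto intro: card_ge_0_finite)
  have "stage ?J (S - {d}) (Suc m)" if "d \<in> S" for d
    using stage_serve[OF st u that] .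
  moreover from this have "finite (edges ?J)"
    using fin online_prefix_finite(2) by (auto simp: stage_def)
  then obtain d where d: "d \<in> S" "real (Suc k) * exposed ?J (S - {d}) \<le> real k * exposed ?J S"
    using remove_most_exposed fin card by (metis diff_Suc_1)
  moreover have "card (S - {d}) = k" using d card fin by simp
  moreover have "gain ?J + c * exposed ?J (S - {d}) \<le> gain I + a * exposed I S + (1 - a)"
  proof -
    have "c * exposed ?J (S - {d}) \<le> a * exposed ?J S"
      using mult_left_mono[OF d(2) c(1)] by (simp add: a_def field_simps)
    then have "gain ?J + c * exposed ?J (S - {d})
        \<le> (1 - a) * gain ?J + a * (gain ?J + exposed ?J S)"
      by (simp add: algebra_simps)
    also have "\<dots> \<le> (1 - a) * (gain I + 1) + a * (gain I + exposed I S)"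
      using serve_expectation[OF st u] a by (intro add_mono[OF mult_left_mono mult_left_mono]) auto
    finally show ?thesis by (simp add: algebra_simps)
  qed
  ultimately show ?thesis unfolding a_def by blast
qed

text \<open>Along the phase the product of coefficient and number of live vertices stays
  \<open>c * j\<close>, so the step that starts with \<open>i\<close> live vertices costs
  \<open>1 - c * j / i\<close>.\<close>

lemma serve_phase:
  assumes "stage I S m" "card S = j + t" "0 < j" "0 \<le> c" "c \<le> 1"
  shows "\<exists>J T. stage J T (m + t) \<and> card T = j \<and>
    gain J + c * exposed J T
      \<le> gain I + c * real j / real (j + t) * exposed I S + (\<Sum>i\<in>{j<..j + t}. 1 - c * real j / real i)"
  using assms
proof (induction t arbitrary: I S m)
  case 0
  then show ?case by (intro exI[of _ I] exI[of _ S]) simp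
next
  case (Suc t)
  \<comment> \<open>The coefficient required after the first step, when \<open>j + t\<close>
    vertices are live.\<close>
  define a where "a = c * real j / real (j + t)"
  have a: "0 \<le> a" "a * real (j + t) = c * real j"
    using Suc.prems by (simp_all add: a_def)
  have "c * real j \<le> 1 * real j" using Suc.prems by (intro mult_right_mono) auto
  then have "a * real (j + t) \<le> real (Suc (j + t))" using a by simp
  from serve_step[OF Suc.prems(1) _ a(1) this] Suc.prems(2) obtain J T where
    J: "stage J T (Suc m)" "card T = j + t"
    and le: "gain J + a * exposed J T \<le> gain I + c * real j / real (Suc (j + t)) * exposed I S
      + (1 - c * real j / real (Suc (j + t)))"
    unfolding a(2) by auto
  from Suc.IH[OF J Suc.prems(3-5)] obtain J' T' where J': "stage J' T' (Suc m + t)" "card T' = j"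
    and le': "gain J' + c * exposed J' T'
      \<le> gain J + a * exposed J T + (\<Sum>i\<in>{j<..j + t}. 1 - c * real j / real i)"
    unfolding a_def by blast
  have "{j<..j + Suc t} = insert (Suc (j + t)) {j<..j + t}" by auto
  then have "(\<Sum>i\<in>{j<..j + Suc t}. 1 - c * real j / real i)
      = (1 - c * real j / real (Suc (j + t))) + (\<Sum>i\<in>{j<..j + t}. 1 - c * real j / real i)"
    by simp
  then have "gain J' + c * exposed J' T' \<le> gain I + c * real j / real (j + Suc t) * exposed I S
      + (\<Sum>i\<in>{j<..j + Suc t}. 1 - c * real j / real i)"
    using le le' by simp
  then show ?case using J' by (intro exI[of _ J'] exI[of _ T']) simp
qed

text \<open>The convex combination of the single step again, now with
  \<open>a = c * (b - s) / b\<close> for \<open>s = card S\<close>: \<open>gain\<close> is bounded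
  by the old \<open>gain + exposed\<close>, and the conserved sum starts at
  \<open>gain + b\<close>.\<close>

lemma replace_phase:
  assumes st: "stage I S m" and b: "card S \<le> b" "0 < b"
    and c: "0 \<le> c" "c * real (b - card S) \<le> real b"
  shows "\<exists>J T. stage J T (m + card S) \<and> card T = b - card S \<and>
    gain J + c * exposed J T \<le> gain I + (1 - c * real (b - card S) / real b) * exposed I S
      + c * real (b - card S)"
proof -
  have "finite (verts I)" using st online_prefix_finite by (auto simp: stage_def)
  then obtain ws where ws: "distinct ws" "set ws \<inter> verts I = {}" "length ws = b"
    by (rule fresh_vertices)
  have cardws: "card (set ws) = b" using ws distinct_card by auto
  let ?J = "replace_live S ws I"
  define a where "a = c * real (b - card S) / real b"
  have a: "a \<le> 1" "0 \<le> a" using b c by (simp_all add: a_def)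
  have "finite (edges ?J)"
    using st online_prefix_finite(2)[of I] stage_finite[OF st]
    by (auto simp: replace_live_def stage_def intro!: finite_image_set2)
  then obtain D where D: "D \<subseteq> set ws" "card D = card S"
    "real b * exposed ?J (set ws - D) \<le> real (b - card S) * exposed ?J (set ws)"
    using remove_most_exposed_set[of ?J "set ws" "card S"] b cardws by auto
  have "stage ?J (set ws - D) (m + card S)"
    using stage_replace_live[OF st ws(1,2) D(1,2)] .
  moreover have "card (set ws - D) = b - card S"
    using D cardws by (metis List.finite_set card_Diff_subset finite_subset)
  moreover have "gain ?J + c * exposed ?J (set ws - D)
      \<le> gain I + (1 - a) * exposed I S + c * real (b - card S)"
  proof -
    have "c * exposed ?J (set ws - D) \<le> a * exposed ?J (set ws)"
      using mult_left_mono[OF D(3) c(1)] b by (simp add: a_def field_simps)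
    then have "gain ?J + c * exposed ?J (set ws - D)
        \<le> (1 - a) * gain ?J + a * (gain ?J + exposed ?J (set ws))"
      by (simp add: algebra_simps)
    also have "\<dots> \<le> (1 - a) * (gain I + exposed I S) + a * (gain I + real b)"
      using replace_live_expectation[OF st ws(1,2)] ws(3) a
      by (intro add_mono[OF mult_left_mono mult_left_mono]) auto
    also have "\<dots> = gain I + (1 - a) * exposed I S + a * real b"
      by (simp add: algebra_simps)
    also have "a * real b = c * real (b - card S)" using b by (simp add: a_def)
    finally show ?thesis .
  qed
  ultimately show ?thesis unfolding a_def by blast
qed

text \<open>
  The coefficients \<open>c\<close> are chosen backwards: 1 before the last phase, then \<open>13/32\<close>, and
  \<open>1 - 13/42 = 29/42\<close> before the replacement.
\<close>

lemma hard_instance: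
  "\<exists>I. valid_instance I \<and> bipartite (verts I) (edges I) \<and> 50 \<le> OPT I \<and> gain I \<le> 0.6317 * 50"
proof -
  obtain I0 S0 where 0: "stage I0 S0 0" "card S0 = 18" and fm: "\<And>p. final_matching p I0 = {}"
    using stage_init[of 18] by blast
  have e0: "gain I0 = 0" "exposed I0 S0 = 18"
    using exposed_eq_card[of S0 I0] 0 fm by (simp_all add: expected_size_def)
  obtain I1 S1 where 1: "stage I1 S1 8" "card S1 = 10"
    and e1: "gain I1 + (29/42) * exposed I1 S1 \<le> gain I0 + (29/42) * 10 / 18 * exposed I0 S0
      + (\<Sum>i\<in>{10<..18}. 1 - (29/42) * 10 / real i)"
    using serve_phase[OF 0(1), of 10 8 "29/42"] 0(2) by auto
  \<comment> \<open>With \<open>b = 42\<close> and 10 live vertices,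
    \<open>a = (13/32) * 32 / 42 = 13/42\<close>; the old coefficient is therefore
    \<open>29/42\<close> and the constant is \<open>(13/32) * 32 = 13\<close>.\<close>
  obtain I2 S2 where 2: "stage I2 S2 18" "card S2 = 32"
    and e2: "gain I2 + (13/32) * exposed I2 S2 \<le> gain I1 + (29/42) * exposed I1 S1 + 13"
    using replace_phase[OF 1(1), of 42 "13/32"] 1(2) by auto
  \<comment> \<open>19 steps from 32 to 13 live vertices with final coefficient 1, hence
    \<open>13/32\<close> at the start.\<close>
  obtain I3 S3 where 3: "stage I3 S3 37" "card S3 = 13"
    and e3: "gain I3 + exposed I3 S3 \<le> gain I2 + (13/32) * exposed I2 S2
      + (\<Sum>i\<in>{13<..32}. 1 - 13 / real i)"
    using serve_phase[OF 2(1), of 13 19 1] 2(2) by auto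
  \<comment> \<open>The last partners: \<open>b = card S3\<close> leaves no live vertex, so
    \<open>c = 0\<close> suffices.\<close>
  obtain I4 S4 where 4: "stage I4 S4 50" and e4: "gain I4 \<le> gain I3 + exposed I3 S3"
    using replace_phase[OF 3(1), of 13 0] 3(2) by auto
  obtain J where J: "valid_instance J" "bipartite (verts J) (edges J)" "50 \<le> OPT J"
    and fmJ: "\<And>p. final_matching p J = final_matching p I4"
    using stage_complete[OF 4] by blast
  have "gain J = gain I4" by (simp add: expected_size_def fmJ)
  also have "\<dots> \<le> (29/42) * 10 + (\<Sum>i\<in>{10<..18}. 1 - (29/42) * 10 / real i) + 13
      + (\<Sum>i\<in>{13<..32}. 1 - 13 / real i)"
    using e0 e1 e2 e3 e4 by simp
  \<comment> \<open>Both sums are unfolded into explicit fractions; the left side is about 31.577,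
    the right side 31.585.\<close>
  also have "\<dots> \<le> 0.6317 * 50"
    by (simp add: numeral_eq_Suc atLeastSucAtMost_greaterThanAtMost[symmetric])
  finally show ?thesis using J by blast
qed

end

theorem theorem3:
  fixes W :: "'w measure" and A :: "'w \<Rightarrow> policy"
  assumes "randomized_algorithm W A"
  shows "competitive_ratio W A \<le> 0.6317"
proof -
  interpret randomized_fom W A by unfold_locales (rule assms)
  obtain I where I: "valid_instance I" "bipartite (verts I) (edges I)" "50 \<le> OPT I"
    and le: "expected_size W A I \<le> 0.6317 * 50"
    using hard_instance by blast
  have nonneg: "0 \<le> expected_size W A J" for J
    by (simp add: expected_size_def)
  have "competitive_ratio W A \<le> expected_size W A I / real (OPT I)"
    unfolding competitive_ratio_def
    \<comment> \<open>An infimum of reals lies below its members only if the set is bounded below;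
      here 0 is a bound.\<close>
    using I nonneg by (intro cINF_lower bdd_belowI[where m = 0]) auto
  also have "\<dots> \<le> expected_size W A I / 50"
    using I(3) nonneg by (intro divide_left_mono) auto
  also have "\<dots> \<le> 0.6317" using le by simp
  finally show ?thesis .
qed

end
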